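(* For any $\varepsilon>0$ and $n\in\mathbb{N}$, there exists $w=w(n)>0$ such that any distribution-free property tester for $\mathsf{HAM}(w)$ (with proximity parameter $\varepsilon$) requires $\Omega(n^{1/3-0.0005})$ queries.
   Context: For $X\in\{0,1\}^n$, $\mathsf{Hwt}(X)$ is the number of ones in $X$. For a weight $w$, $\mathsf{HAM}(w)$ is the set of $X\in\{0,1\}^n$ with $\mathsf{Hwt}(X)=w$. For a distribution $\mathcal{D}$ over $[n]$, $d_{\mathcal{D}}(x,y)=\Pr_{i\sim\mathcal{D}}[x_i\neq y_i]$ and $d_{\mathcal{D}}(x,L)=\min_{y\in L}d_{\mathcal{D}}(x,y)$. A distribution-free property tester for $L$ with proximity $\varepsilon$ is a randomized algorithm with query access to $X$ and access to a sample oracle returning $(i,X_i)$ for $i\sim\mathcal{D}$ independently, such that for every $X$ and every unknown distribution $\mathcal{D}$ over $[n]$: if $X\in L$ it accepts with probability $\ge 2/3$, and if $d_{\mathcal{D}}(X,L)>\varepsilon$ it rejects with probability $\ge 2/3$. The lower bound counts queries and labelled samples.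
   Formalization: The proximity parameter is restricted to 0 < ε < 1, since for ε ≥ 1 no input is ε-far and the tester that always accepts needs no queries; n ≥ 1 is assumed, as there is no distribution over the empty index set, and w ≤ n is ensured so that HAM(w) is nonempty. *)

theory Defs
  imports "HOL-Probability.Probability"
begin

text \<open>
  Strings in \<open>{0,1}^n\<close> are Boolean lists of length \<open>n\<close>, with \<open>[n]\<close> rendered as \<open>{..<n}\<close>.
\<close>

definition Hwt :: "bool list \<Rightarrow> nat" where
  "Hwt X = card {i. i < length X \<and> X ! i}"

definition HAM :: "nat \<Rightarrow> nat \<Rightarrow> bool list set" where
  "HAM n w = {X. length X = n \<and> Hwt X = w}"

definition dist_wrt :: "nat pmf \<Rightarrow> bool list \<Rightarrow> bool list \<Rightarrow> real" where
  "dist_wrt D x y = measure_pmf.prob D {i. x ! i \<noteq> y ! i}"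

text \<open>
  Only meaningful for finite nonempty \<open>L\<close>, as is the case for \<open>HAM n w\<close> with \<open>w \<le> n\<close>.
\<close>

definition dist_to_set :: "nat pmf \<Rightarrow> bool list \<Rightarrow> bool list set \<Rightarrow> real" where
  "dist_to_set D x L = Min (dist_wrt D x ` L)"

text \<open>
  A deterministic adaptive algorithm: it outputs a verdict (\<open>True\<close> means accept), or queries a
  position and continues with the bit found there, or asks the sample oracle for a labelled
  sample and continues with the pair of index and label. A randomized algorithm draws all its
  internal randomness in advance, so it is a distribution over such decision trees.
\<close>

datatype dtree =
    Output bool
  | Query nat "bool \<Rightarrow> dtree"
  | Sample "nat \<Rightarrow> bool \<Rightarrow> dtree"

type_synonym rand_alg = "dtree pmf"

primrec run_dtree :: "dtree \<Rightarrow> bool list \<Rightarrow> nat pmf \<Rightarrow> bool pmf" where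
  "run_dtree (Output b) X D = return_pmf b"
| "run_dtree (Query i f) X D = run_dtree (f (X ! i)) X D"
| "run_dtree (Sample f) X D = bind_pmf D (\<lambda>i. run_dtree (f i (X ! i)) X D)"

definition run :: "rand_alg \<Rightarrow> bool list \<Rightarrow> nat pmf \<Rightarrow> bool pmf" where
  "run T X D = bind_pmf T (\<lambda>t. run_dtree t X D)"

text \<open>
  \<open>dtree_cost_le n q t\<close>: on inputs of length \<open>n\<close>, every execution path of \<open>t\<close> queries only
  positions below \<open>n\<close> and uses at most \<open>q\<close> queries and labelled samples in total.
\<close>

inductive dtree_cost_le :: "nat \<Rightarrow> nat \<Rightarrow> dtree \<Rightarrow> bool" for n :: nat where
  "dtree_cost_le n q (Output b)"
| "i < n \<Longrightarrow> (\<And>b. dtree_cost_le n q (f b)) \<Longrightarrow> dtree_cost_le n (Suc q) (Query i f)"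
| "(\<And>i b. i < n \<Longrightarrow> dtree_cost_le n q (f i b)) \<Longrightarrow> dtree_cost_le n (Suc q) (Sample f)"

definition cost_le :: "nat \<Rightarrow> nat \<Rightarrow> rand_alg \<Rightarrow> bool" where
  "cost_le n q T \<longleftrightarrow> (\<forall>t\<in>set_pmf T. dtree_cost_le n q t)"

definition dist_free_tester :: "nat \<Rightarrow> bool list set \<Rightarrow> real \<Rightarrow> rand_alg \<Rightarrow> bool" where
  "dist_free_tester n L \<epsilon> T \<longleftrightarrow>
     (\<forall>X D. length X = n \<longrightarrow> set_pmf D \<subseteq> {..<n} \<longrightarrow>
        (X \<in> L \<longrightarrow> pmf (run T X D) True \<ge> 2 / 3) \<and>
        (dist_to_set D X L > \<epsilon> \<longrightarrow> pmf (run T X D) False \<ge> 2 / 3))"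

end

theory Submission
  imports Defs
begin

text \<open>
  Let \<open>S\<close> be a uniformly random set of \<open>m\<close> positions, \<open>X\<close> its indicator string and \<open>D\<close> the uniform
  distribution on \<open>S\<close>. For \<open>m = w\<close> this is a member of \<open>HAM n w\<close>; for \<open>m = K * w\<close> with
  \<open>K > 1 / (1 - \<epsilon>)\<close> it is \<open>\<epsilon>\<close>-far from \<open>HAM n w\<close>, since at least \<open>m - w\<close> ones have to be flipped.
  As long as no sample repeats an earlier index and no query hits an unsampled one, the algorithm sees
  the same in both cases: fresh uniform indices labelled \<open>1\<close>, and zeros as answers to queries.
  Within \<open>q\<close> steps the first event has probability at most \<open>q\<^sup>2 / m\<close> and the second at most
  \<open>q * m / (n - q)\<close>. Taking \<open>w\<close> of order \<open>n\<close> to the power \<open>2/3\<close> makes both small unless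
  \<open>q\<close> is of order \<open>n\<close> to the power \<open>1/3\<close>.
\<close>

section \<open>Consistent supports and the idealised run\<close>

text \<open>These are the supports still consistent with a transcript that has placed
  \<open>A\<close> inside and \<open>Z\<close> outside. Conditioning the uniformly random support on
  the transcript becomes counting in this family.\<close>

definition sets_between :: "nat \<Rightarrow> nat \<Rightarrow> nat set \<Rightarrow> nat set \<Rightarrow> nat set set" where
  "sets_between n m A Z = {S. A \<subseteq> S \<and> S \<subseteq> {..<n} - Z \<and> card S = m}"

definition indicator_string :: "nat \<Rightarrow> nat set \<Rightarrow> bool list" where
  "indicator_string n S = map (\<lambda>i. i \<in> S) [0..<n]"

text \<open>\<open>A\<close> collects the indices sampled so far and \<open>Z\<close> the queried ones that were answered by \<open>0\<close>.\<close>

primrec ideal_run :: "nat \<Rightarrow> dtree \<Rightarrow> nat set \<Rightarrow> nat set \<Rightarrow> bool pmf" where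
  "ideal_run n (Output b) A Z = return_pmf b"
| "ideal_run n (Query i f) A Z =
     (if i \<in> A then ideal_run n (f True) A Z else ideal_run n (f False) A (insert i Z))"
| "ideal_run n (Sample f) A Z =
     bind_pmf (pmf_of_set ({..<n} - A - Z)) (\<lambda>i. ideal_run n (f i True) (insert i A) Z)"

lemma indicator_string_simps [simp]:
  "length (indicator_string n S) = n"
  "i < n \<Longrightarrow> indicator_string n S ! i \<longleftrightarrow> i \<in> S"
  by (auto simp: indicator_string_def)

lemma Hwt_indicator_string:
  assumes "S \<subseteq> {..<n}"
  shows "Hwt (indicator_string n S) = card S"
proof -
  have "{i. i < n \<and> indicator_string n S ! i} = S"
    using assms by auto
  then show ?thesis by (simp add: Hwt_def)
qed

section \<open>Counting consistent supports\<close>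

lemma finite_sets_between [simp]: "finite (sets_between n m A Z)"
  by (rule finite_subset[of _ "Pow {..<n}"]) (auto simp: sets_between_def)

text \<open>Removing \<open>A\<close> leaves an arbitrary choice among the undecided positions.
  Without \<open>card A \<le> m\<close> the family is empty, while truncated subtraction would turn
  the binomial into 1.\<close>

lemma card_sets_between:
  assumes "A \<subseteq> {..<n}" "Z \<subseteq> {..<n}" "A \<inter> Z = {}" "card A \<le> m"
  shows "card (sets_between n m A Z) = (n - card A - card Z) choose (m - card A)"
proof -
  have fin: "finite A" "finite Z" using assms finite_subset by blast+
  have "bij_betw (\<lambda>S. S - A) (sets_between n m A Z)
          {B. B \<subseteq> {..<n} - (A \<union> Z) \<and> card B = m - card A}"
  proof (rule bij_betwI[where g = "\<lambda>B. B \<union> A"])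
    show "(\<lambda>S. S - A) \<in> sets_between n m A Z \<rightarrow>
            {B. B \<subseteq> {..<n} - (A \<union> Z) \<and> card B = m - card A}"
      using fin by (auto simp: sets_between_def card_Diff_subset)
    show "(\<lambda>B. B \<union> A) \<in> {B. B \<subseteq> {..<n} - (A \<union> Z) \<and> card B = m - card A} \<rightarrow>
            sets_between n m A Z"
    proof
      fix B assume B: "B \<in> {B. B \<subseteq> {..<n} - (A \<union> Z) \<and> card B = m - card A}"
      then have "finite B" using finite_subset by blast
      then have "card (B \<union> A) = card B + card A"
        using B fin by (intro card_Un_disjoint) auto
      then show "B \<union> A \<in> sets_between n m A Z"
        using B assms by (auto simp: sets_between_def)
    qed
  qed (auto simp: sets_between_def)
  then have "card (sets_between n m A Z) = card ({..<n} - (A \<union> Z)) choose (m - card A)"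
    by (simp add: bij_betw_same_card n_subsets)
  also have "card ({..<n} - (A \<union> Z)) = n - card A - card Z"
    using assms fin by (simp add: card_Diff_subset card_Un_disjoint)
  finally show ?thesis .
qed

text \<open>An undecided position lies in a random consistent support with probability (m - |A|) /
  (n - |A| - |Z|), the same for every such position. The product form avoids division; it is the
  absorption identity for binomials.\<close>

lemma card_sets_between_insert:
  assumes "A \<subseteq> {..<n}" "Z \<subseteq> {..<n}" "A \<inter> Z = {}" "card A \<le> m"
    and "i < n" "i \<notin> A" "i \<notin> Z"
  shows "card (sets_between n m (insert i A) Z) * (n - card A - card Z) =
           (m - card A) * card (sets_between n m A Z)"
proof (cases "m = card A")
  case True
  have fin: "finite A" using assms finite_subset by blast
  have "sets_between n m (insert i A) Z = {}"
  proof (rule ccontr)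
    assume "sets_between n m (insert i A) Z \<noteq> {}"
    then obtain S where "insert i A \<subseteq> S" "S \<subseteq> {..<n}" "card S = m"
      by (auto simp: sets_between_def)
    then have "card (insert i A) \<le> m"
      using card_mono[of S "insert i A"] finite_subset by blast
    then show False using True fin assms(6) by simp
  qed
  then show ?thesis using True by simp
next
  case False
  have fin: "finite A" "finite Z" using assms finite_subset by blast+
  \<comment> \<open>The position \<open>i\<close> is itself undecided, so the number of undecided
    positions is a successor.\<close>
  have "card (insert i (A \<union> Z)) \<le> card {..<n}"
    using assms by (intro card_mono) auto
  then obtain N where N: "n - card A - card Z = Suc N"
    using assms fin by (cases "n - card A - card Z") (auto simp: card_Un_disjoint)
  obtain k where k: "m - card A = Suc k"
    using False assms(4) by (cases "m - card A") auto
  have "card (sets_between n m A Z) = Suc N choose Suc k"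
    using card_sets_between[OF assms(1-4)] N k by simp
  moreover have "card (sets_between n m (insert i A) Z) = N choose k"
  proof -
    have "n - card (insert i A) - card Z = N" "m - card (insert i A) = k"
      using N k fin assms(6) by auto
    moreover have "card (insert i A) \<le> m" using k fin assms(6) by simp
    ultimately show ?thesis
      using card_sets_between[of "insert i A" n Z m] assms by simp
  qed
  ultimately show ?thesis
    using Suc_times_binomial_eq[of N k] N k by (simp add: ac_simps)
qed

section \<open>Real run against ideal run\<close>

text \<open>Each step costs at most \<open>q / m\<close> (a sample repeats an index) plus
  \<open>m / (n - q)\<close> (a query hits the support). The ideal run does not mention
  \<open>m\<close>, so it can serve two weights at once. A one-sided bound is enough because
  \<open>b\<close> is arbitrary. Sums over supports replace conditional probabilities, so nothing
  breaks when no consistent support remains.\<close>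

lemma ideal_run_lower_bound:
  assumes "dtree_cost_le n k t"
    and "A \<subseteq> {..<n}" "Z \<subseteq> {..<n}" "A \<inter> Z = {}"
    and "card A + card Z + k \<le> q" "q < n" "q \<le> m" "0 < m"
  shows "real (card (sets_between n m A Z)) *
           (pmf (ideal_run n t A Z) b - real k * (real q / real m + real m / real (n - q)))
         \<le> (\<Sum>S\<in>sets_between n m A Z. pmf (run_dtree t (indicator_string n S) (pmf_of_set S)) b)"
  using assms(1-5)
proof (induction k t arbitrary: A Z rule: dtree_cost_le.induct)
  case (1 k c)
  have "0 \<le> real k * (real q / real m + real m / real (n - q))" by simp
  then show ?case
    by (simp add: mult_left_mono)
next
  case (2 i k f)
  define d where "d = real q / real m + real m / real (n - q)"
  have d0: "0 \<le> d" by (simp add: d_def)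
  have fin: "finite A" "finite Z" using "2.prems" finite_subset by blast+
  let ?g = "\<lambda>t S. pmf (run_dtree t (indicator_string n S) (pmf_of_set S)) b"
  show ?case
  proof (cases "i \<in> A")
    case True
    have "real (card (sets_between n m A Z)) * (pmf (ideal_run n (Query i f) A Z) b - real (Suc k) * d)
          \<le> real (card (sets_between n m A Z)) * (pmf (ideal_run n (f True) A Z) b - real k * d)"
      using True d0 by (intro mult_left_mono) (auto simp: algebra_simps)
    also have "\<dots> \<le> (\<Sum>S\<in>sets_between n m A Z. ?g (f True) S)"
      unfolding d_def using "2.prems" by (intro "2.IH") auto
    also have "\<dots> = (\<Sum>S\<in>sets_between n m A Z. ?g (Query i f) S)"
    proof (rule sum.cong[OF refl])
      fix S assume "S \<in> sets_between n m A Z"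
      then have "indicator_string n S ! i = True"
        using True "2.hyps" by (auto simp: sets_between_def)
      then show "?g (f True) S = ?g (Query i f) S" by simp
    qed
    finally show ?thesis by (simp only: d_def)
  next
    case False
    define r where "r = pmf (ideal_run n (f False) A (insert i Z)) b - real k * d"
    have r1: "r \<le> 1"
      using mult_nonneg_nonneg[OF of_nat_0_le_iff[of k] d0]
        pmf_le_1[of "ideal_run n (f False) A (insert i Z)" b]
      unfolding r_def by linarith
    \<comment> \<open>Supports containing \<open>i\<close> answer 1 where the ideal run assumes 0.
      Their nonnegative contribution is discarded, and \<open>hit\<close> bounds their share by
      \<open>d\<close>.\<close>
    have part: "sets_between n m A Z = sets_between n m A (insert i Z) \<union> sets_between n m (insert i A) Z"
      and disj: "sets_between n m A (insert i Z) \<inter> sets_between n m (insert i A) Z = {}"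
      by (auto simp: sets_between_def)
    have cardF: "card (sets_between n m A Z) =
        card (sets_between n m A (insert i Z)) + card (sets_between n m (insert i A) Z)"
      by (subst part, rule card_Un_disjoint) (use disj in auto)
    have hit: "real (card (sets_between n m (insert i A) Z)) \<le> real (card (sets_between n m A Z)) * d"
    proof (cases "i \<in> Z")
      case True
      then have "sets_between n m (insert i A) Z = {}" by (auto simp: sets_between_def)
      then show ?thesis using d0 by simp
    next
      case iZ: False
      have *: "card (sets_between n m (insert i A) Z) * (n - card A - card Z) =
           (m - card A) * card (sets_between n m A Z)"
        using "2.hyps" "2.prems" False iZ assms(7) by (intro card_sets_between_insert) auto
      have "card (sets_between n m (insert i A) Z) * (n - q) \<le>
            card (sets_between n m (insert i A) Z) * (n - card A - card Z)"
        using "2.prems" by (intro mult_left_mono) auto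
      also have "\<dots> \<le> m * card (sets_between n m A Z)"
        unfolding * by (intro mult_right_mono) auto
      finally have "real (card (sets_between n m (insert i A) Z)) * real (n - q) \<le>
          real m * real (card (sets_between n m A Z))"
        by (metis of_nat_le_iff of_nat_mult)
      then have "real (card (sets_between n m (insert i A) Z)) \<le>
          real (card (sets_between n m A Z)) * (real m / real (n - q))"
        using assms by (simp add: field_simps)
      also have "\<dots> \<le> real (card (sets_between n m A Z)) * d"
        by (intro mult_left_mono) (auto simp: d_def)
      finally show ?thesis .
    qed
    \<comment> \<open>The discarded part contributes at most its cardinality since
      \<open>r \<le> 1\<close>, and this is paid for by the \<open>d\<close> term. The value
      \<open>r\<close> may be negative.\<close>
    have "real (card (sets_between n m A Z)) * (r - d) =
          real (card (sets_between n m A (insert i Z))) * r +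
          real (card (sets_between n m (insert i A) Z)) * r - real (card (sets_between n m A Z)) * d"
      by (simp add: cardF algebra_simps)
    also have "\<dots> \<le> real (card (sets_between n m A (insert i Z))) * r"
      using hit mult_left_mono[OF r1, of "real (card (sets_between n m (insert i A) Z))"] by simp
    also have "\<dots> \<le> (\<Sum>S\<in>sets_between n m A (insert i Z). ?g (f False) S)"
      unfolding r_def d_def using "2.hyps" "2.prems" False fin by (intro "2.IH") (auto simp: card_insert_if)
    also have "\<dots> = (\<Sum>S\<in>sets_between n m A (insert i Z). ?g (Query i f) S)"
    proof (rule sum.cong[OF refl])
      fix S assume "S \<in> sets_between n m A (insert i Z)"
      then have "indicator_string n S ! i = False"
        using "2.hyps" by (auto simp: sets_between_def)
      then show "?g (f False) S = ?g (Query i f) S" by simp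
    qed
    also have "\<dots> \<le> (\<Sum>S\<in>sets_between n m A Z. ?g (Query i f) S)"
      using part by (intro sum_mono2) auto
    also have "r - d = pmf (ideal_run n (Query i f) A Z) b - real (Suc k) * d"
      using False by (simp add: r_def algebra_simps)
    finally show ?thesis by (simp only: d_def)
  qed
next
  case (3 k f)
  define d where "d = real q / real m + real m / real (n - q)"
  have d0: "0 \<le> d" by (simp add: d_def)
  have fin: "finite A" "finite Z" using "3.prems" finite_subset by blast+
  let ?g = "\<lambda>t S. pmf (run_dtree t (indicator_string n S) (pmf_of_set S)) b"
  let ?U = "{..<n} - A - Z"
  let ?r = "\<lambda>i. pmf (ideal_run n (f i True) (insert i A) Z) b"
  define N where "N = n - card A - card Z"
  have "?U = {..<n} - (A \<union> Z)" by auto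
  then have cardU: "card ?U = N"
    using "3.prems" fin by (simp add: N_def card_Diff_subset card_Un_disjoint)
  have Npos: "0 < N" using "3.prems" assms by (simp add: N_def)
  then have U: "finite ?U" "?U \<noteq> {}" using cardU card_gt_0_iff[of ?U] by simp_all
  have Am: "card A \<le> m" "card A \<le> q" using "3.prems" assms by auto
  define R where "R = pmf (ideal_run n (Sample f) A Z) b"
  have R: "R = (\<Sum>i\<in>?U. ?r i) / real N"
    unfolding R_def using U by (simp add: pmf_bind integral_pmf_of_set cardU)
  have R1: "R - real k * d \<le> 1"
    using mult_nonneg_nonneg[OF of_nat_0_le_iff[of k] d0] pmf_le_1[of "ideal_run n (Sample f) A Z" b]
    unfolding R_def by linarith
  \<comment> \<open>Samples are drawn from the support itself, so every label is 1.\<close>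
  have step: "?g (Sample f) S = (\<Sum>i\<in>S. ?g (f i True) S) / real m"
    if "S \<in> sets_between n m A Z" for S
  proof -
    have S: "finite S" "S \<noteq> {}" "card S = m" "S \<subseteq> {..<n}"
      using that assms finite_subset[of S "{..<n}"] by (auto simp: sets_between_def)
    have "(\<Sum>i\<in>S. ?g (f i (indicator_string n S ! i)) S) = (\<Sum>i\<in>S. ?g (f i True) S)"
    proof (rule sum.cong[OF refl])
      fix i assume "i \<in> S"
      then have "indicator_string n S ! i = True" using S by auto
      then show "?g (f i (indicator_string n S ! i)) S = ?g (f i True) S" by simp
    qed
    then show ?thesis using S by (simp add: pmf_bind integral_pmf_of_set)
  qed
  have cardi: "real (card (sets_between n m (insert i A) Z)) =
      (real m - real (card A)) / real N * real (card (sets_between n m A Z))" if "i \<in> ?U" for i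
  proof -
    have "card (sets_between n m (insert i A) Z) * N = (m - card A) * card (sets_between n m A Z)"
      unfolding N_def using "3.prems" that Am by (intro card_sets_between_insert) auto
    then have "real (card (sets_between n m (insert i A) Z)) * real N =
        (real m - real (card A)) * real (card (sets_between n m A Z))"
      using Am by (metis of_nat_diff of_nat_mult)
    then show ?thesis using Npos by (simp add: field_simps)
  qed
  have small: "(real m - real (card A)) / real m \<ge> 1 - d"
  proof -
    have "real (card A) / real m \<le> real q / real m" using Am by (intro divide_right_mono) auto
    also have "\<dots> \<le> d" by (simp add: d_def)
    finally show ?thesis using assms by (simp add: diff_divide_distrib)
  qed
  \<comment> \<open>With a = |A| / m the chance of a repeated index, the factor 1 - a loses a * (R -
    k * d), which is at most a and hence at most \<open>d\<close>.\<close>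
  have frac: "R - real (Suc k) * d \<le> (real m - real (card A)) / real m * (R - real k * d)"
  proof -
    define a where "a = real (card A) / real m"
    have "0 \<le> a" "a \<le> d" using small assms by (auto simp: a_def diff_divide_distrib)
    then have "a * (R - real k * d) \<le> d"
      using mult_left_mono[OF R1, of a] by simp
    then show ?thesis using assms by (simp add: diff_divide_distrib a_def algebra_simps)
  qed
  have "real (card (sets_between n m A Z)) * (R - real (Suc k) * d)
        \<le> real (card (sets_between n m A Z)) * ((real m - real (card A)) / real m * (R - real k * d))"
    by (intro mult_left_mono frac) auto
  \<comment> \<open>The weight of a consistent family after adding \<open>i\<close> does not depend
    on \<open>i\<close>, so the average \<open>R\<close> over undecided positions can be expanded
    with these weights.\<close>
  also have "\<dots> = (\<Sum>i\<in>?U. (real m - real (card A)) / real N * real (card (sets_between n m A Z)) *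
       (?r i - real k * d)) / real m"
  proof -
    have *: "(\<Sum>i\<in>?U. ?r i - real k * d) = real N * (R - real k * d)"
      using Npos by (simp add: R sum_subtractf cardU right_diff_distrib)
    show ?thesis unfolding sum_distrib_left[symmetric] * using Npos by simp
  qed
  also have "\<dots> = (\<Sum>i\<in>?U. real (card (sets_between n m (insert i A) Z)) * (?r i - real k * d)) / real m"
    by (simp add: cardi)
  also have "\<dots> \<le> (\<Sum>i\<in>?U. \<Sum>S\<in>sets_between n m (insert i A) Z. ?g (f i True) S) / real m"
  proof (intro divide_right_mono sum_mono)
    fix i assume i: "i \<in> ?U"
    show "real (card (sets_between n m (insert i A) Z)) * (?r i - real k * d)
          \<le> (\<Sum>S\<in>sets_between n m (insert i A) Z. ?g (f i True) S)"
      unfolding d_def using "3.prems" i fin by (intro "3.IH") auto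
  qed simp
  \<comment> \<open>Double counting of pairs of a consistent support and a fresh index in it; such a
    support avoids \<open>Z\<close>, so its fresh indices are exactly \<open>S - A\<close>.\<close>
  also have "(\<Sum>i\<in>?U. \<Sum>S\<in>sets_between n m (insert i A) Z. ?g (f i True) S) =
      (\<Sum>S\<in>sets_between n m A Z. \<Sum>i\<in>S - A. ?g (f i True) S)"
  proof -
    have fS: "finite S" if "S \<in> sets_between n m A Z" for S
      using that finite_subset[of S "{..<n}"] by (auto simp: sets_between_def)
    have "(\<Sum>i\<in>?U. \<Sum>S\<in>sets_between n m (insert i A) Z. ?g (f i True) S) =
        (\<Sum>(i, S)\<in>Sigma ?U (\<lambda>i. sets_between n m (insert i A) Z). ?g (f i True) S)"
      using U by (intro sum.Sigma) auto
    also have "\<dots> = (\<Sum>(S, i)\<in>Sigma (sets_between n m A Z) (\<lambda>S. S - A). ?g (f i True) S)"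
      by (rule sum.reindex_bij_witness[where i = prod.swap and j = prod.swap])
        (auto simp: sets_between_def)
    also have "\<dots> = (\<Sum>S\<in>sets_between n m A Z. \<Sum>i\<in>S - A. ?g (f i True) S)"
      using fS by (intro sum.Sigma[symmetric]) auto
    finally show ?thesis .
  qed
  \<comment> \<open>Putting the repeated indices back only adds nonnegative terms.\<close>
  also have "(\<Sum>S\<in>sets_between n m A Z. \<Sum>i\<in>S - A. ?g (f i True) S) / real m \<le>
      (\<Sum>S\<in>sets_between n m A Z. \<Sum>i\<in>S. ?g (f i True) S) / real m"
  proof (intro divide_right_mono sum_mono sum_mono2)
    fix S assume "S \<in> sets_between n m A Z"
    then show "finite S" using finite_subset[of S "{..<n}"] by (auto simp: sets_between_def)
  qed auto
  also have "\<dots> = (\<Sum>S\<in>sets_between n m A Z. ?g (Sample f) S)"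
    using step by (simp add: sum_divide_distrib del: run_dtree.simps)
  finally show ?case by (simp only: R_def d_def)
qed

lemma pmf_bind_pmf_mono_diff:
  assumes "\<And>x. x \<in> set_pmf p \<Longrightarrow> pmf (f x) b - e \<le> pmf (g x) b"
  shows "pmf (bind_pmf p f) b - e \<le> pmf (bind_pmf p g) b"
proof -
  have int: "integrable (measure_pmf p) (\<lambda>x. pmf (h x) b)" for h :: "'a \<Rightarrow> 'b pmf"
    by (rule measure_pmf.integrable_const_bound[where B = 1]) (auto simp: pmf_le_1)
  have "(\<integral>x. pmf (f x) b - e \<partial>measure_pmf p) \<le> (\<integral>x. pmf (g x) b \<partial>measure_pmf p)"
    using assms int by (intro integral_mono_AE) (auto simp: AE_measure_pmf_iff)
  then show ?thesis using int by (simp add: pmf_bind)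
qed

text \<open>The comparison is averaged over the trees of \<open>T\<close>, starting from the empty
  transcript. Swapping the choice of tree with the choice of support then allows the bound
  \<open>B\<close>, which concerns the whole randomized algorithm on one instance.\<close>

lemma random_instance_lower_bound:
  assumes "cost_le n q T" "q < n" "q \<le> m" "0 < m" "m \<le> n"
    and "\<And>S. S \<subseteq> {..<n} \<Longrightarrow> card S = m \<Longrightarrow>
           pmf (run T (indicator_string n S) (pmf_of_set S)) b \<le> B"
  shows "pmf (bind_pmf T (\<lambda>t. ideal_run n t {} {})) b \<le>
           B + real q * (real q / real m + real m / real (n - q))"
proof -
  let ?F = "sets_between n m {} {}"
  let ?run = "\<lambda>t S. run_dtree t (indicator_string n S) (pmf_of_set S)"
  define e where "e = real q * (real q / real m + real m / real (n - q))"
  have "{..<m} \<in> ?F" using assms by (auto simp: sets_between_def)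
  then have F: "finite ?F" "?F \<noteq> {}" by auto
  then have cF: "0 < real (card ?F)" by (simp add: card_gt_0_iff)
  have "pmf (bind_pmf T (\<lambda>t. ideal_run n t {} {})) b - e \<le>
        pmf (bind_pmf T (\<lambda>t. bind_pmf (pmf_of_set ?F) (?run t))) b"
  proof (rule pmf_bind_pmf_mono_diff)
    fix t assume "t \<in> set_pmf T"
    then have "dtree_cost_le n q t" using assms by (auto simp: cost_le_def)
    then have "real (card ?F) * (pmf (ideal_run n t {} {}) b - e) \<le> (\<Sum>S\<in>?F. pmf (?run t S) b)"
      unfolding e_def using assms by (intro ideal_run_lower_bound) auto
    also have "\<dots> = real (card ?F) * pmf (bind_pmf (pmf_of_set ?F) (?run t)) b"
      using F cF by (simp add: pmf_bind integral_pmf_of_set)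
    finally show "pmf (ideal_run n t {} {}) b - e \<le> pmf (bind_pmf (pmf_of_set ?F) (?run t)) b"
      using cF by simp
  qed
  also have "bind_pmf T (\<lambda>t. bind_pmf (pmf_of_set ?F) (?run t)) =
      bind_pmf (pmf_of_set ?F) (\<lambda>S. run T (indicator_string n S) (pmf_of_set S))"
    unfolding run_def by (rule bind_commute_pmf)
  also have "pmf \<dots> b = (\<Sum>S\<in>?F. pmf (run T (indicator_string n S) (pmf_of_set S)) b) / real (card ?F)"
    using F by (simp add: pmf_bind integral_pmf_of_set)
  also have "\<dots> \<le> (\<Sum>S\<in>?F. B) / real (card ?F)"
    using assms(6) by (intro divide_right_mono sum_mono) (auto simp: sets_between_def)
  also have "\<dots> = B" using F by simp
  finally show ?thesis by (simp add: e_def)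
qed

section \<open>Hard instances and the tester's error\<close>

lemma finite_HAM: "finite (HAM n w)"
  using finite_lists_length_eq[of "UNIV :: bool set" n]
  by (rule rev_finite_subset) (auto simp: HAM_def)

text \<open>A string with \<open>w\<close> ones disagrees with the indicator of \<open>S\<close> on
  at least |S| - w elements of \<open>S\<close>. The bound \<open>w \<le> n\<close> makes
  \<open>HAM n w\<close> nonempty, so that \<open>Min\<close> is meaningful.\<close>

lemma dist_to_set_HAM_gr:
  assumes "S \<subseteq> {..<n}" "0 < card S" "w \<le> n" and "\<epsilon> < 1 - real w / real (card S)"
  shows "\<epsilon> < dist_to_set (pmf_of_set S) (indicator_string n S) (HAM n w)"
proof -
  have S: "finite S" "S \<noteq> {}" using assms card_gt_0_iff[of S] by auto
  have "Hwt (indicator_string n {..<w}) = card {..<w}"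
    using assms by (intro Hwt_indicator_string) auto
  then have "indicator_string n {..<w} \<in> HAM n w" by (simp add: HAM_def)
  then have ne: "HAM n w \<noteq> {}" by auto
  have "\<epsilon> < dist_wrt (pmf_of_set S) (indicator_string n S) Y" if "Y \<in> HAM n w" for Y
  proof -
    have Y: "length Y = n" "card {i. i < n \<and> Y ! i} = w"
      using that by (auto simp: HAM_def Hwt_def)
    have "card S - w \<le> card (S - {i. i < n \<and> Y ! i})"
      using Y(2) diff_card_le_card_Diff[of "{i. i < n \<and> Y ! i}" S] by simp
    also have "\<dots> \<le> card (S \<inter> {i. indicator_string n S ! i \<noteq> Y ! i})"
      using S assms by (intro card_mono) auto
    finally have "real (card S) - real w \<le> real (card (S \<inter> {i. indicator_string n S ! i \<noteq> Y ! i}))"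
      by linarith
    then have "(real (card S) - real w) / real (card S) \<le>
        dist_wrt (pmf_of_set S) (indicator_string n S) Y"
      unfolding dist_wrt_def using S by (simp add: measure_pmf_of_set divide_right_mono)
    then show ?thesis using assms by (simp add: diff_divide_distrib)
  qed
  then show ?thesis
    unfolding dist_to_set_def using ne finite_HAM by (subst Min_gr_iff) auto
qed

lemma pmf_bool_sum: "pmf p True + pmf p False = 1"
  by (simp add: pmf_False_conv_True)

text \<open>The same ideal run rejects rarely by comparison with weight \<open>w\<close> and accepts
  rarely by comparison with weight \<open>m\<close>. Its two verdicts have total probability 1, so
  the two comparison errors must make up the missing 1/3.\<close>

lemma tester_error_lower_bound:
  assumes "dist_free_tester n (HAM n w) \<epsilon> T" "cost_le n q T" "q < n" "q \<le> w" "0 < w"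
    and "w \<le> m" "m \<le> n" and "\<epsilon> < 1 - real w / real m"
  shows "1 / 3 \<le> real q * (real q / real w + real w / real (n - q)) +
           real q * (real q / real m + real m / real (n - q))"
proof -
  let ?P = "bind_pmf T (\<lambda>t. ideal_run n t {} {})"
  have "pmf ?P False \<le> 1 / 3 + real q * (real q / real w + real w / real (n - q))"
  proof (rule random_instance_lower_bound)
    fix S assume S: "S \<subseteq> {..<n}" "card S = w"
    then have "finite S" "S \<noteq> {}" using assms card_gt_0_iff[of S] by auto
    moreover have "indicator_string n S \<in> HAM n w"
      using S by (simp add: HAM_def Hwt_indicator_string)
    ultimately have "2 / 3 \<le> pmf (run T (indicator_string n S) (pmf_of_set S)) True"
      using assms(1) S by (auto simp: dist_free_tester_def)
    then show "pmf (run T (indicator_string n S) (pmf_of_set S)) False \<le> 1 / 3"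
      using pmf_bool_sum[of "run T (indicator_string n S) (pmf_of_set S)"] by linarith
  qed (use assms in auto)
  moreover have "pmf ?P True \<le> 1 / 3 + real q * (real q / real m + real m / real (n - q))"
  proof (rule random_instance_lower_bound)
    fix S assume S: "S \<subseteq> {..<n}" "card S = m"
    then have "finite S" "S \<noteq> {}" using assms card_gt_0_iff[of S] by auto
    moreover have "\<epsilon> < dist_to_set (pmf_of_set S) (indicator_string n S) (HAM n w)"
      using S assms by (intro dist_to_set_HAM_gr) auto
    ultimately have "2 / 3 \<le> pmf (run T (indicator_string n S) (pmf_of_set S)) False"
      using assms(1) S by (auto simp: dist_free_tester_def)
    then show "pmf (run T (indicator_string n S) (pmf_of_set S)) True \<le> 1 / 3"
      using pmf_bool_sum[of "run T (indicator_string n S) (pmf_of_set S)"] by linarith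
  qed (use assms in auto)
  ultimately show ?thesis using pmf_bool_sum[of ?P] by linarith
qed

section \<open>Small lengths: at least one query\<close>

lemma run_zero_cost:
  assumes "cost_le n 0 T"
  shows "run T X D = run T X' D'"
  unfolding run_def
proof (rule bind_pmf_cong[OF refl])
  fix t assume "t \<in> set_pmf T"
  then have "dtree_cost_le n 0 t" using assms by (simp add: cost_le_def)
  then show "run_dtree t X D = run_dtree t X' D'" by cases auto
qed

text \<open>Covers the finitely many lengths too small for two weights \<open>w\<close> and
  \<open>K * w\<close>. Under a point mass at 0 the all-ones string is accepted and the all-zeros
  string is at distance 1, yet an algorithm of cost 0 cannot tell them apart.\<close>

lemma tester_full_weight_cost_pos:
  assumes "dist_free_tester n (HAM n n) \<epsilon> T" "cost_le n q T" "0 < n" "\<epsilon> < 1"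
  shows "0 < q"
proof (rule ccontr)
  assume "\<not> 0 < q"
  then have q0: "cost_le n 0 T" using assms by simp
  let ?D = "return_pmf 0 :: nat pmf" and ?X = "indicator_string n {..<n}" and ?X' = "indicator_string n {}"
  have H: "HAM n n = {?X}"
  proof (intro set_eqI iffI)
    fix Y assume "Y \<in> HAM n n"
    then have Y: "length Y = n" "card {i. i < n \<and> Y ! i} = card {..<n}"
      by (auto simp: HAM_def Hwt_def)
    then have "{i. i < n \<and> Y ! i} = {..<n}" by (intro card_subset_eq) auto
    then have Yi: "Y ! i" if "i < n" for i using that by blast
    have "Y = ?X"
    proof (rule nth_equalityI)
      show "length Y = length ?X" using Y by simp
      show "Y ! i = ?X ! i" if "i < length Y" for i using that Y(1) Yi[of i] by simp
    qed
    then show "Y \<in> {?X}" by simp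
  qed (simp add: HAM_def Hwt_indicator_string)
  have D: "set_pmf ?D \<subseteq> {..<n}" using assms(3) by simp
  have XH: "?X \<in> HAM n n" by (simp add: H)
  have tester: "(X \<in> HAM n n \<longrightarrow> 2 / 3 \<le> pmf (run T X ?D) True) \<and>
      (\<epsilon> < dist_to_set ?D X (HAM n n) \<longrightarrow> 2 / 3 \<le> pmf (run T X ?D) False)"
    if "length X = n" for X
    using assms(1) that D unfolding dist_free_tester_def by blast
  have "2 / 3 \<le> pmf (run T ?X ?D) True"
    using tester[of ?X] XH by simp
  moreover have "\<epsilon> < dist_to_set ?D ?X' (HAM n n)"
    using assms by (simp add: H dist_to_set_def dist_wrt_def)
  then have "2 / 3 \<le> pmf (run T ?X' ?D) False"
    using tester[of ?X'] by simp
  moreover have "run T ?X' ?D = run T ?X ?D" by (rule run_zero_cost[OF q0])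
  ultimately show False using pmf_bool_sum[of "run T ?X ?D"] by simp
qed

section \<open>Choice of parameters\<close>

theorem theorem3p15:
  fixes \<epsilon> :: real
  assumes "0 < \<epsilon>" and "\<epsilon> < 1"
  shows "\<exists>c>0. \<forall>n\<ge>1. \<exists>w>0. w \<le> n \<and>
           (\<forall>T q. dist_free_tester n (HAM n w) \<epsilon> T \<and> cost_le n q T \<longrightarrow>
              real q \<ge> c * real n powr (1 / 3 - 0.0005))"
proof -
  obtain K :: nat where K: "max 2 (1 / (1 - \<epsilon>)) < real K"
    using reals_Archimedean2 by blast
  then have K2: "2 < real K" and Ke: "\<epsilon> < 1 - 1 / real K"
    using assms by (auto simp: field_simps)
  \<comment> \<open>Chosen so that q < c * x and m \<le> K * x^2 give q * m \<le> n / 100;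
    \<open>K > 2\<close> makes \<open>c\<close> less than 1/200.\<close>
  define c where "c = 1 / (100 * real K)"
  have c: "0 < c" "c * real K = 1 / 100" "c < 1 / 200" using K2 by (auto simp: c_def field_simps)
  have "\<exists>w>0. w \<le> n \<and> (\<forall>T q. dist_free_tester n (HAM n w) \<epsilon> T \<and> cost_le n q T \<longrightarrow>
              real q \<ge> c * real n powr (1 / 3 - 0.0005))" if n: "1 \<le> n" for n
  proof -
    define x where "x = real n powr (1 / 3)"
    have x1: "1 \<le> x" using n by (simp add: x_def ge_one_powr_ge_zero)
    have x3: "x ^ 3 = real n"
      using n by (simp add: x_def powr_powr flip: powr_realpow)
    \<comment> \<open>The argument yields the full exponent 1/3; the smaller exponent follows
      because \<open>n \<ge> 1\<close>.\<close>
    have xle: "c * real n powr (1 / 3 - 0.0005) \<le> c * x"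
      unfolding x_def using n c by (intro mult_left_mono powr_mono) auto
    show ?thesis
    proof (cases "x < real K")
      case True
      \<comment> \<open>Here the claimed bound is at most 1, so \<open>w = n\<close> and a positive
        cost suffice.\<close>
      then have "c * x \<le> 1" using mult_strict_left_mono[OF True c(1)] c by simp
      then have "real q \<ge> c * real n powr (1 / 3 - 0.0005)"
        if "dist_free_tester n (HAM n n) \<epsilon> T" "cost_le n q T" for T q
        using tester_full_weight_cost_pos[OF that] n assms xle by linarith
      then show ?thesis using n by (intro exI[of _ n]) auto
    next
      case False
      \<comment> \<open>Of order \<open>n\<close> to the power 2/3, which balances q^2 / w against q
        * w / n at q of order \<open>x\<close>. As \<open>x \<ge> K\<close>, the larger weight
        \<open>K * w\<close> still fits into \<open>n\<close>.\<close>
      define w where "w = nat \<lfloor>x\<^sup>2\<rfloor>"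
      have x2: "1 \<le> x\<^sup>2" using x1 by simp
      then have w0: "1 \<le> w" by (simp add: w_def le_nat_iff le_floor_iff)
      have wx: "real w \<le> x\<^sup>2" using x2 by (simp add: w_def)
      have xw: "x\<^sup>2 \<le> 2 * real w" using x2 w0 unfolding w_def by linarith
      have "real K * real w \<le> x * x\<^sup>2" using False wx x1 by (intro mult_mono) auto
      also have "\<dots> = real n" using x3 by (simp add: power3_eq_cube power2_eq_square)
      finally have Kwn: "K * w \<le> n" by (metis of_nat_le_iff of_nat_mult)
      have wKw: "w \<le> K * w" using K2 by (cases K) auto
      have "real q \<ge> c * real n powr (1 / 3 - 0.0005)"
        if T: "dist_free_tester n (HAM n w) \<epsilon> T" "cost_le n q T" for T q
      proof (rule ccontr)
        assume "\<not> real q \<ge> c * real n powr (1 / 3 - 0.0005)"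
        then have qc: "real q < c * x" using xle by linarith
        also have "\<dots> \<le> x / 200" using c x1 by (simp add: mult_right_mono)
        finally have qx: "real q \<le> x / 200" by simp
        have xx: "x \<le> x\<^sup>2" "x \<le> real n"
          unfolding x3[symmetric] using x1 by (auto simp: self_le_power)
        have qw: "q \<le> w" using qx xx xw x1 by linarith
        have qn: "q < n" "real n / 2 \<le> real (n - q)" using qx xx x1 by linarith+
        \<comment> \<open>Used for both \<open>m = w\<close> and \<open>m = K * w\<close>: the two
          errors together are at most 1/5, less than the required 1/3.\<close>
        have err: "real q * (real q / real m + real m / real (n - q)) \<le> 1 / 10"
          if m: "w \<le> m" "m \<le> K * w" for m
        proof -
          have m0: "0 < real m" "x\<^sup>2 / 2 \<le> real m" using m w0 xw by linarith+
          have "real q * real q \<le> (x / 200) * (x / 200)" using qx by (intro mult_mono) auto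
          also have "\<dots> \<le> real m / 100"
            using m0 by (simp add: power2_eq_square)
          finally have 1: "real q * (real q / real m) \<le> 1 / 100"
            using m0 by (simp add: field_simps)
          have "real m \<le> real K * real w" using m by (metis of_nat_le_iff of_nat_mult)
          also have "\<dots> \<le> real K * x\<^sup>2" using wx by (intro mult_left_mono) auto
          finally have "real q * real m \<le> (c * x) * (real K * x\<^sup>2)"
            using qc c x1 by (intro mult_mono) auto
          also have "\<dots> = (c * real K) * x ^ 3" by (simp add: power3_eq_cube power2_eq_square)
          also have "\<dots> = real n / 100" using c x3 by simp
          also have "\<dots> \<le> real (n - q) / 50" using qn by simp
          finally have 2: "real q * (real m / real (n - q)) \<le> 1 / 50"
            using qn by (simp add: field_simps)
          show ?thesis unfolding distrib_left by (rule order_trans[OF add_mono[OF 1 2]]) simp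
        qed
        have "\<epsilon> < 1 - real w / real (K * w)" using Ke w0 by simp
        then have "1 / 3 \<le> real q * (real q / real w + real w / real (n - q)) +
           real q * (real q / real (K * w) + real (K * w) / real (n - q))"
          using T qn qw w0 wKw Kwn by (intro tester_error_lower_bound) auto
        then show False using err[of w] err[of "K * w"] wKw by linarith
      qed
      moreover have "w \<le> n" using wKw Kwn by (rule order_trans)
      ultimately show ?thesis using w0 by (intro exI[of _ w]) auto
    qed
  qed
  then show ?thesis using c by blast
qed

end
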